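(* For every integer $n>14$, $$R_3(n) = 2R_3(n-1) - R_3(n-2) + R_3(n-3) - 2R_3(n-4) + R_3(n-5),$$ where $R_3(n)$ is the number of partitions of $n$ with max-rook number $3$.
   Context: A partition $\pi$ of a positive integer $n$ is a non-increasing sequence of positive integers $(\lambda_1,\dots,\lambda_r)$ with sum $n$; $\mathscr{P}(n)$ is the set of all partitions of $n$. The Ferrers board $B_\pi$ of $\pi=(\lambda_1,\dots,\lambda_r)$ is the left-justified array of unit squares with $r$ rows whose $i$-th row from the top has $\lambda_i$ squares. Rooks placed on squares of the board are non-intersecting if no two of them lie in the same row or the same column. The max-rook number $R(\pi)$ is the maximal number of non-intersecting rooks that can be placed in $B_\pi$. For positive integers $n,k$, $R_k(n):=\#\{\pi\in\mathscr{P}(n) : R(\pi)=k\}$. *)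

theory Defs
  imports Main
begin

definition partitions :: "nat \<Rightarrow> nat list set" where
  "partitions n = {p. sorted_wrt (\<ge>) p \<and> (\<forall>l\<in>set p. 0 < l) \<and> sum_list p = n}"

text \<open>Squares are pairs (row, column), both counted from 0, row 0 at the top.\<close>

definition ferrers_board :: "nat list \<Rightarrow> (nat \<times> nat) set" where
  "ferrers_board p = {(i, j). i < length p \<and> j < p ! i}"

definition non_intersecting :: "(nat \<times> nat) set \<Rightarrow> bool" where
  "non_intersecting S \<longleftrightarrow>
     (\<forall>s\<in>S. \<forall>t\<in>S. s \<noteq> t \<longrightarrow> fst s \<noteq> fst t \<and> snd s \<noteq> snd t)"

definition max_rook :: "nat list \<Rightarrow> nat" where
  "max_rook p = Max {card S | S. S \<subseteq> ferrers_board p \<and> non_intersecting S}"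

definition rook_count :: "nat \<Rightarrow> nat \<Rightarrow> nat" where
  "rook_count k n = card {p \<in> partitions n. max_rook p = k}"

text \<open>\<^const>\<open>card\<close> and \<^const>\<open>Max\<close> are only meaningful on finite
  (respectively finite and nonempty) sets; the following facts ensure this.\<close>

lemma finite_partitions: "finite (partitions n)"
proof (rule finite_subset)
  have "length p \<le> sum_list p" if "\<forall>l\<in>set p. 0 < l" for p :: "nat list"
    using that by (induction p) fastforce+
  moreover have "l \<le> sum_list p" if "l \<in> set p" for l and p :: "nat list"
    using that by (simp add: member_le_sum_list)
  ultimately show "partitions n \<subseteq> {p. set p \<subseteq> {..n} \<and> length p \<le> n}"
    by (auto simp: partitions_def)
  show "finite {p. set p \<subseteq> {..n} \<and> length p \<le> n}"
    by (rule finite_lists_length_le) simp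
qed

lemma finite_ferrers_board: "finite (ferrers_board p)"
proof -
  have "ferrers_board p = Sigma {..<length p} (\<lambda>i. {..<p ! i})"
    by (auto simp: ferrers_board_def)
  then show ?thesis
    by simp
qed

lemma finite_rook_placements:
  "finite {card S | S. S \<subseteq> ferrers_board p \<and> non_intersecting S}"
  by (rule finite_subset[of _ "card ` Pow (ferrers_board p)"])
    (auto simp: finite_ferrers_board)

lemma rook_placements_nonempty:
  "{card S | S. S \<subseteq> ferrers_board p \<and> non_intersecting S} \<noteq> {}"
  by (auto simp: non_intersecting_def intro: exI[of _ "{}"])

end

theory Submission
  imports Defs
begin

text \<open>
  For a Ferrers board, $R(\pi) \ge k$ holds exactly when the board contains the staircase
  $(k, k-1, \dots, 1)$ (lemma \<open>le_max_rook_iff_contains_staircase\<close>). Hence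
  $R(\pi) = 3$ means $\lambda_1 \ge 3$, $\lambda_2 \ge 2$, $\lambda_3 \ge 1$ (missing parts being 0),
  together with
  $\lambda_1 \le 3$ or $\lambda_2 \le 2$ or $\lambda_3 \le 1$ or $\lambda_4 = 0$. These
  partitions split into five disjoint families, according to whether
  $\lambda_1 = \lambda_2 = 3$; or $\lambda_1 = 3$, $\lambda_2 = 2$; or
  $\lambda_1 \ge 4$, $\lambda_2 = 2$; or $\lambda_1 \ge 4$, $\lambda_2 \ge 3$,
  $\lambda_3 = 1$; or $\lambda_1 \ge 4$, $\lambda_2 \ge 3$, $\lambda_3 \ge 2$,
  $\lambda_4 = 0$. Each family is parametrised by the solutions in natural numbers of a linear
  equation, except that one solution is left out in each of the last three. With $P_2(n)$,
  $P_3(n)$ and $T(n)$ the numbers of solutions of $a+2b=n$, $a+2b+3c=n$ and $d+a+2b=n$, this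
  gives, for $n \ge 10$ (lemma \<open>rook_count_3\<close>),
  \[ R_3(n) = 2P_3(n-6) + P_2(n-5) + T(n-6) + T(n-7) - 3. \]

  The characteristic polynomial of the recurrence is $(1-x)^2(1-x^3)$, where $x$ stands for the
  shift from $n$ to $n-1$. From
  $P_2(n) = \lfloor n/2 \rfloor + 1$, $P_3(n) - P_3(n-3) = P_2(n)$ and
  $T(n) - T(n-1) = P_2(n)$ it follows that the floors cancel in $R_3(n) - R_3(n-3)$, which is
  therefore linear in $n$ and annihilated by $(1-x)^2$. The formula is used down to $n-5$,
  hence the bound $n > 14$.
\<close>

section \<open>Rook numbers and staircases\<close>

text \<open>The board of \<open>p\<close> contains the board of $(k, k-1, \dots, 1)$. Rows are
  counted from 0, so row \<open>i\<close> of the staircase has length \<open>k - i\<close>.\<close>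

definition contains_staircase :: "nat \<Rightarrow> nat list \<Rightarrow> bool" where
  "contains_staircase k p \<longleftrightarrow> (\<forall>i<k. i < length p \<and> k - i \<le> p ! i)"

lemma contains_staircase_0 [simp]: "contains_staircase 0 p"
  by (simp add: contains_staircase_def)

lemma contains_staircase_Nil [simp]: "contains_staircase (Suc k) [] \<longleftrightarrow> False"
  by (auto simp: contains_staircase_def)

lemma contains_staircase_Cons [simp]:
  "contains_staircase (Suc k) (x # p) \<longleftrightarrow> Suc k \<le> x \<and> contains_staircase k p"
  unfolding contains_staircase_def All_less_Suc2 by simp

text \<open>At most \<open>i\<close> of the rooks stand in the first \<open>i\<close> rows. The
  remaining ones occupy distinct columns, all of them among the first \<open>p ! i\<close>.\<close>

lemma card_rooks_le:
  assumes "sorted_wrt (\<ge>) p" and S: "S \<subseteq> ferrers_board p" "non_intersecting S"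
    and i: "i < card S"
  shows "i < length p \<and> card S - i \<le> p ! i"
proof -
  define U where "U = {s \<in> S. fst s < i}"
  define L where "L = {s \<in> S. i \<le> fst s}"
  have fin: "finite S"
    using S(1) finite_ferrers_board by (rule finite_subset)
  have inj: "inj_on fst S" "inj_on snd S"
    using S(2) unfolding non_intersecting_def inj_on_def by metis+
  have "card U = card (fst ` U)"
    by (rule card_image[symmetric]) (auto intro: inj_on_subset[OF inj(1)] simp: U_def)
  also have "\<dots> \<le> card {..<i}"
    by (rule card_mono) (auto simp: U_def)
  finally have U: "card U \<le> i" by simp
  have "S = U \<union> L" "U \<inter> L = {}" "finite U" "finite L"
    using fin by (auto simp: U_def L_def)
  then have "card S = card U + card L"
    by (metis card_Un_disjoint)
  with U have L: "card S - i \<le> card L" by simp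
  with i have "L \<noteq> {}" by auto
  then obtain r c where "(r, c) \<in> S" "i \<le> r" by (auto simp: L_def)
  with S(1) have len: "i < length p"
    by (auto simp: ferrers_board_def)
  have "snd ` L \<subseteq> {..<p ! i}"
  proof
    fix c assume "c \<in> snd ` L"
    then obtain r where r: "(r, c) \<in> S" "i \<le> r" by (auto simp: L_def)
    with S(1) have "r < length p" "c < p ! r"
      by (auto simp: ferrers_board_def)
    moreover from this r have "p ! r \<le> p ! i"
      using sorted_wrt_nth_less[OF assms(1), of i r] by (cases "i = r") auto
    ultimately show "c \<in> {..<p ! i}" by simp
  qed
  then have "card (snd ` L) \<le> p ! i"
    using card_mono[of "{..<p ! i}"] by fastforce
  moreover have "card (snd ` L) = card L"
    by (rule card_image) (auto intro: inj_on_subset[OF inj(2)] simp: L_def)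
  ultimately show ?thesis using len L by simp
qed

lemma le_max_rook_iff_contains_staircase:
  assumes "sorted_wrt (\<ge>) p"
  shows "k \<le> max_rook p \<longleftrightarrow> contains_staircase k p"
proof
  assume k: "k \<le> max_rook p"
  have "max_rook p \<in> {card S | S. S \<subseteq> ferrers_board p \<and> non_intersecting S}"
    unfolding max_rook_def
    by (rule Max_in[OF finite_rook_placements rook_placements_nonempty])
  then obtain S where S: "max_rook p = card S" "S \<subseteq> ferrers_board p" "non_intersecting S"
    by auto
  show "contains_staircase k p"
    unfolding contains_staircase_def
  proof (intro allI impI)
    fix i assume "i < k"
    with k S(1) card_rooks_le[OF assms S(2,3), of i]
    show "i < length p \<and> k - i \<le> p ! i" by linarith
  qed
next
  assume st: "contains_staircase k p"
  \<comment> \<open>The rooks are placed at the end of each row of the staircase.\<close>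
  define S where "S = (\<lambda>i. (i, k - 1 - i)) ` {..<k}"
  have "S \<subseteq> ferrers_board p"
    using st by (fastforce simp: S_def contains_staircase_def ferrers_board_def)
  moreover have "non_intersecting S"
    by (auto simp: S_def non_intersecting_def)
  moreover have "card S = k"
    unfolding S_def by (subst card_image) (auto simp: inj_on_def)
  ultimately show "k \<le> max_rook p"
    unfolding max_rook_def using finite_rook_placements by (intro Max_ge) auto
qed

lemma max_rook_eq_iff:
  assumes "sorted_wrt (\<ge>) p"
  shows "max_rook p = k \<longleftrightarrow> contains_staircase k p \<and> \<not> contains_staircase (Suc k) p"
  using le_max_rook_iff_contains_staircase[OF assms, of k]
    le_max_rook_iff_contains_staircase[OF assms, of "Suc k"] by linarith


section \<open>Partitions with small parts\<close>

lemma sorted_split_largest: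
  assumes "sorted_wrt (\<ge>) p" and "\<forall>l\<in>set p. l \<le> Suc m"
  shows "\<exists>c q. p = replicate c (Suc m) @ q \<and> (\<forall>l\<in>set q. l \<le> m)"
  using assms
proof (induction p)
  case (Cons x p)
  show ?case
  proof (cases "x = Suc m")
    case True
    with Cons obtain c q where "p = replicate c (Suc m) @ q" "\<forall>l\<in>set q. l \<le> m"
      by auto
    with True show ?thesis
      by (intro exI[of _ "Suc c"] exI[of _ q]) simp
  next
    case False
    with Cons.prems have "x \<le> m" by simp
    with Cons.prems show ?thesis
      by (intro exI[of _ 0] exI[of _ "x # p"]) auto
  qed
qed simp

lemma sorted_replicate_ge [simp]: "sorted_wrt (\<ge>) (replicate n (x::nat))"
  by (simp add: sorted_wrt_iff_nth_less)

text \<open>The partition with \<open>a\<close> parts equal to 1 and \<open>b\<close> parts equal to 2.\<close>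

definition ones_twos :: "nat \<Rightarrow> nat \<Rightarrow> nat list" where
  "ones_twos a b = replicate b 2 @ replicate a 1"

lemma le_1_eq_replicate:
  fixes p :: "nat list"
  assumes "\<forall>l\<in>set p. 0 < l \<and> l \<le> 1"
  shows "p = replicate (length p) 1"
  using assms by (intro replicate_eqI) auto

lemma sorted_le_2:
  assumes "sorted_wrt (\<ge>) p" and "\<forall>l\<in>set p. 0 < l \<and> l \<le> 2"
  shows "\<exists>a b. p = ones_twos a b"
proof -
  have "\<exists>c q. p = replicate c 2 @ q \<and> (\<forall>l\<in>set q. l \<le> 1)"
    using sorted_split_largest[OF assms(1), of 1] assms(2) by (simp add: numeral_2_eq_2)
  then obtain c q where q: "p = replicate c 2 @ q" "\<forall>l\<in>set q. l \<le> 1"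
    by blast
  from q(1) have "set q \<subseteq> set p" by simp
  with q(2) assms(2) have "q = replicate (length q) 1"
    by (intro le_1_eq_replicate) blast
  with q(1) show ?thesis
    unfolding ones_twos_def by metis
qed

lemma sorted_le_3:
  assumes "sorted_wrt (\<ge>) p" and "\<forall>l\<in>set p. 0 < l \<and> l \<le> 3"
  shows "\<exists>a b c. p = replicate c 3 @ ones_twos a b"
proof -
  have "\<exists>c q. p = replicate c 3 @ q \<and> (\<forall>l\<in>set q. l \<le> 2)"
    using sorted_split_largest[OF assms(1), of 2] assms(2) by simp
  then obtain c q where q: "p = replicate c 3 @ q" "\<forall>l\<in>set q. l \<le> 2"
    by blast
  from q(1) have "set q \<subseteq> set p" by simp
  with q(2) assms(2) have "\<forall>l\<in>set q. 0 < l \<and> l \<le> 2" by blast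
  moreover from assms(1) q(1) have "sorted_wrt (\<ge>) q"
    by (simp only: sorted_wrt_append)
  ultimately obtain a b where "q = ones_twos a b"
    using sorted_le_2 by blast
  with q(1) show ?thesis by blast
qed

lemma ones_twos_eq_iff: "ones_twos a b = ones_twos a' b' \<longleftrightarrow> a = a' \<and> b = b'"
proof
  assume eq: "ones_twos a b = ones_twos a' b'"
  have "length (filter (\<lambda>l. l = 1) (ones_twos a b)) = a"
    "length (filter (\<lambda>l. l = 2) (ones_twos a b)) = b" for a b
    by (simp_all add: ones_twos_def)
  with eq show "a = a' \<and> b = b'" by metis
qed simp

lemma threes_ones_twos_eq_iff:
  "replicate c 3 @ ones_twos a b = replicate c' 3 @ ones_twos a' b'
    \<longleftrightarrow> a = a' \<and> b = b' \<and> c = c'"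
proof
  assume eq: "replicate c 3 @ ones_twos a b = replicate c' 3 @ ones_twos a' b'"
  have "length (filter (\<lambda>l. l = 3) (replicate c 3 @ ones_twos a b)) = c" for a b c
    by (simp add: ones_twos_def)
  with eq have "c = c'" by metis
  with eq show "a = a' \<and> b = b' \<and> c = c'" by (simp add: ones_twos_eq_iff)
qed simp

lemma sorted_sum_ones_twos [simp]:
  "sorted_wrt (\<ge>) (ones_twos a b)"
  "sum_list (ones_twos a b) = a + 2 * b"
  by (auto simp: ones_twos_def sorted_wrt_append sum_list_replicate)

lemma ones_twos_bounds: "\<forall>l\<in>set (ones_twos a b). 0 < l \<and> l \<le> 2"
  by (auto simp: ones_twos_def)

lemma ones_twos_upper:
  assumes "2 \<le> x" shows "\<forall>l\<in>set (ones_twos a b). l \<le> x"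
  using assms ones_twos_bounds le_trans by blast

lemma ones_twos_pos: "\<forall>l\<in>set (ones_twos a b). 0 < l"
  using ones_twos_bounds by blast


section \<open>Counting solutions of linear equations\<close>

text \<open>Solutions in natural numbers; the digits in the names are the coefficients.\<close>

definition sols12 :: "nat \<Rightarrow> (nat \<times> nat) set" where
  "sols12 n = {(a, b). a + 2 * b = n}"

definition sols123 :: "nat \<Rightarrow> (nat \<times> nat \<times> nat) set" where
  "sols123 n = {(a, b, c). a + 2 * b + 3 * c = n}"

definition sols112 :: "nat \<Rightarrow> (nat \<times> nat \<times> nat) set" where
  "sols112 n = {(d, a, b). d + a + 2 * b = n}"

lemma finite_sols [simp]: "finite (sols12 n)" "finite (sols123 n)" "finite (sols112 n)"
proof -
  show "finite (sols12 n)"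
    by (rule finite_subset[of _ "{..n} \<times> {..n}"]) (auto simp: sols12_def)
  show "finite (sols123 n)"
    by (rule finite_subset[of _ "{..n} \<times> {..n} \<times> {..n}"]) (auto simp: sols123_def)
  show "finite (sols112 n)"
    by (rule finite_subset[of _ "{..n} \<times> {..n} \<times> {..n}"]) (auto simp: sols112_def)
qed

lemma card_sols12: "card (sols12 n) = n div 2 + 1"
proof -
  have "sols12 n = (\<lambda>b. (n - 2 * b, b)) ` {..n div 2}"
    by (auto simp: sols12_def image_iff)
  then show ?thesis by (simp add: card_image inj_on_def)
qed

lemma card_sols123_add_3: "card (sols123 (n + 3)) = card (sols123 n) + card (sols12 (n + 3))"
proof -
  let ?f = "\<lambda>(a, b, c). (a, b, Suc c)" and ?g = "\<lambda>(a, b). (a, b, 0 :: nat)"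
  have "(a, b, c) \<in> sols123 (n + 3) \<longleftrightarrow> (a, b, c) \<in> ?f ` sols123 n \<union> ?g ` sols12 (n + 3)"
    for a b c
    by (cases c) (auto simp: sols123_def sols12_def image_iff)
  then have "sols123 (n + 3) = ?f ` sols123 n \<union> ?g ` sols12 (n + 3)"
    by (intro set_eqI) (metis prod_cases3)
  also have "card \<dots> = card (?f ` sols123 n) + card (?g ` sols12 (n + 3))"
    by (rule card_Un_disjoint) auto
  also have "\<dots> = card (sols123 n) + card (sols12 (n + 3))"
    by (simp add: card_image inj_on_def split: prod.splits)
  finally show ?thesis .
qed

lemma card_sols112_Suc: "card (sols112 (Suc n)) = card (sols112 n) + card (sols12 (Suc n))"
proof -
  let ?f = "\<lambda>(d, a, b). (Suc d, a, b)" and ?g = "\<lambda>(a, b). (0 :: nat, a, b)"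
  have "(d, a, b) \<in> sols112 (Suc n) \<longleftrightarrow> (d, a, b) \<in> ?f ` sols112 n \<union> ?g ` sols12 (Suc n)"
    for d a b
    by (cases d) (auto simp: sols112_def sols12_def image_iff)
  then have "sols112 (Suc n) = ?f ` sols112 n \<union> ?g ` sols12 (Suc n)"
    by (intro set_eqI) (metis prod_cases3)
  also have "card \<dots> = card (?f ` sols112 n) + card (?g ` sols12 (Suc n))"
    by (rule card_Un_disjoint) auto
  also have "\<dots> = card (sols112 n) + card (sols12 (Suc n))"
    by (simp add: card_image inj_on_def split: prod.splits)
  finally show ?thesis .
qed


section \<open>Partitions with max-rook number 3\<close>

text \<open>The five families. Truncated subtraction makes these sets meaningful as sets of partitions
  of \<open>n\<close> only when \<open>n\<close> is large enough.\<close>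

text \<open>$\lambda_1 = \lambda_2 = 3$: all further parts are at most 3.\<close>

definition shapes33 :: "nat \<Rightarrow> nat list set" where
  "shapes33 n = (\<lambda>(a, b, c). 3 # 3 # replicate c 3 @ ones_twos a b) ` sols123 (n - 6)"

text \<open>$\lambda_1 = 3$ and $\lambda_2 = 2$.\<close>

definition shapes32 :: "nat \<Rightarrow> nat list set" where
  "shapes32 n = (\<lambda>(a, b). 3 # 2 # ones_twos a b) ` sols12 (n - 5)"

text \<open>$\lambda_1 \ge 4$ and $\lambda_2 = 2$: a long first row above parts at most 2. The
  solution removed would give a partition with only two parts.\<close>

definition shapes_row :: "nat \<Rightarrow> nat list set" where
  "shapes_row n = (\<lambda>(d, a, b). (4 + d) # 2 # ones_twos a b) ` (sols112 (n - 6) - {(n - 6, 0, 0)})"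

text \<open>$\lambda_1 \ge 4$, $\lambda_2 \ge 3$ and $\lambda_3 = 1$, where \<open>b\<close> is
  $\lambda_2 - 3$ and \<open>d\<close> is $\lambda_1 - \lambda_2$. The solution removed would give
  $\lambda_1 = \lambda_2 = 3$.\<close>

definition shapes_hook :: "nat \<Rightarrow> nat list set" where
  "shapes_hook n = (\<lambda>(d, a, b). (3 + b + d) # (3 + b) # 1 # replicate a 1) `
     (sols112 (n - 7) - {(0, n - 7, 0)})"

text \<open>$\lambda_1 \ge 4$, $\lambda_2 \ge 3$, $\lambda_3 \ge 2$ and no fourth part: to
  the right of the first two columns there are \<open>c\<close> columns of height 3, \<open>b\<close> of height 2 and
  \<open>a\<close> of height 1. The solution removed would give $\lambda_2 = 2$.\<close>

definition shapes_rows :: "nat \<Rightarrow> nat list set" where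
  "shapes_rows n = (\<lambda>(a, b, c). [2 + c + b + a, 2 + c + b, 2 + c]) `
     (sols123 (n - 6) - {(n - 6, 0, 0)})"

lemmas shapes_defs = shapes33_def shapes32_def shapes_row_def shapes_hook_def shapes_rows_def

lemma contains_staircase_Suc:
  "contains_staircase (Suc k) p \<longleftrightarrow> (\<exists>x q. p = x # q \<and> Suc k \<le> x \<and> contains_staircase k q)"
  by (cases p) auto

lemma shapes_complete:
  assumes n: "n \<ge> 10" and part: "p \<in> partitions n"
    and st: "contains_staircase 3 p" "\<not> contains_staircase 4 p"
  shows "p \<in> shapes33 n \<union> shapes32 n \<union> shapes_row n \<union> shapes_hook n \<union> shapes_rows n"
proof -
  have "\<exists>x y z q. p = x # y # z # q \<and> 3 \<le> x \<and> 2 \<le> y"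
    using st(1) by (auto simp: contains_staircase_Suc numeral_3_eq_3 numeral_2_eq_2)
  then obtain x y z q where p: "p = x # y # z # q" and xy: "3 \<le> x" "2 \<le> y"
    by blast
  have sorted: "sorted_wrt (\<ge>) (z # q)" "y \<le> x" "z \<le> y" "\<forall>l\<in>set q. l \<le> z"
    and pos: "\<forall>l\<in>set (z # q). 0 < l" and sum: "x + y + z + sum_list q = n"
    using part by (auto simp: partitions_def p)
  consider "x = 3" "y = 3" | "x = 3" "y = 2" | "4 \<le> x" "y = 2"
    | "4 \<le> x" "3 \<le> y" "z = 1" | "4 \<le> x" "3 \<le> y" "2 \<le> z"
  proof -
    have "x = 3 \<or> 4 \<le> x" "y = 2 \<or> 3 \<le> y" "x = 3 \<longrightarrow> y \<le> 3" "z = 1 \<or> 2 \<le> z"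
      using xy sorted(2) pos by auto
    with xy show thesis using that by (metis le_antisym)
  qed
  then show ?thesis
  proof cases
    case 1
    with sorted pos obtain a b c where q: "z # q = replicate c 3 @ ones_twos a b"
      using sorted_le_3[of "z # q"] by fastforce
    have "sum_list (z # q) = 3 * c + a + 2 * b"
      unfolding q by (simp add: sum_list_replicate)
    with 1 sum have "n - 6 = a + 2 * b + 3 * c" by simp
    with 1 p q have "p \<in> shapes33 n"
      by (auto simp: shapes33_def sols123_def intro!: image_eqI[of _ _ "(a, b, c)"])
    then show ?thesis by simp
  next
    case 2
    with sorted pos obtain a b where q: "z # q = ones_twos a b"
      using sorted_le_2[of "z # q"] by fastforce
    have "sum_list (z # q) = a + 2 * b"
      unfolding q by simp
    with 2 sum have "n - 5 = a + 2 * b" by simp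
    with 2 p q have "p \<in> shapes32 n"
      by (auto simp: shapes32_def sols12_def intro!: image_eqI[of _ _ "(a, b)"])
    then show ?thesis by simp
  next
    case 3
    with sorted pos obtain a b where q: "z # q = ones_twos a b"
      using sorted_le_2[of "z # q"] by fastforce
    have "sum_list (z # q) = a + 2 * b"
      unfolding q by simp
    with 3 sum have "n - 6 = (x - 4) + a + 2 * b" by simp
    moreover from q have "a \<noteq> 0 \<or> b \<noteq> 0" by (cases a; cases b) (auto simp: ones_twos_def)
    ultimately have "p \<in> shapes_row n" using 3 p q
      by (auto simp: shapes_row_def sols112_def intro!: image_eqI[of _ _ "(x - 4, a, b)"])
    then show ?thesis by simp
  next
    case 4
    with sorted pos obtain a where q: "q = replicate a 1"
      using le_1_eq_replicate[of q] by auto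
    with 4 sum sorted(2) have "n - 7 = (x - y) + a + 2 * (y - 3)" "x \<noteq> y \<or> y \<noteq> 3"
      by (simp_all add: sum_list_replicate)
    with 4 p q sorted(2) have "p \<in> shapes_hook n"
      by (auto simp: shapes_hook_def sols112_def
          intro!: image_eqI[of _ _ "(x - y, a, y - 3)"])
    then show ?thesis by simp
  next
    case 5
    have "q = []"
    proof (rule ccontr)
      assume "q \<noteq> []"
      then obtain w r where "q = w # r" by (cases q) auto
      with 5 pos have "contains_staircase 4 p"
        by (simp add: p eval_nat_numeral)
      with st(2) show False by contradiction
    qed
    with 5 sum p n sorted(2,3) have "p \<in> shapes_rows n"
      by (auto simp: shapes_rows_def sols123_def
          intro!: image_eqI[of _ _ "(x - y, y - z, z - 2)"])
    then show ?thesis by simp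
  qed
qed

lemma shapes_sound:
  assumes n: "n \<ge> 10"
    and p: "p \<in> shapes33 n \<union> shapes32 n \<union> shapes_row n \<union> shapes_hook n \<union> shapes_rows n"
  shows "p \<in> partitions n \<and> contains_staircase 3 p \<and> \<not> contains_staircase 4 p"
proof -
  have suc: "contains_staircase 3 = contains_staircase (Suc (Suc (Suc 0)))"
    "contains_staircase 4 = contains_staircase (Suc (Suc (Suc (Suc 0))))"
    by (simp_all add: eval_nat_numeral)
  have ones_twos_st: "contains_staircase (Suc 0) (ones_twos a b) \<longleftrightarrow> 0 < a + b" for a b
    by (cases b; cases a) (auto simp: ones_twos_def)
  consider "p \<in> shapes33 n" | "p \<in> shapes32 n" | "p \<in> shapes_row n"
    | "p \<in> shapes_hook n" | "p \<in> shapes_rows n"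
    using p by blast
  then show ?thesis
  proof cases
    case 1
    then obtain a b c where *: "p = 3 # 3 # replicate c 3 @ ones_twos a b" "a + 2 * b + 3 * c = n - 6"
      by (auto simp: shapes33_def sols123_def)
    have "contains_staircase (Suc 0) (replicate c 3 @ ones_twos a b)"
      using * n by (cases c) (auto simp: ones_twos_st)
    moreover have "\<forall>l\<in>set (replicate c 3 @ ones_twos a b). l \<le> 3"
      "\<forall>l\<in>set (replicate c 3 @ ones_twos a b). 0 < l"
      "\<forall>k\<in>set (replicate c 3). \<forall>l\<in>set (ones_twos a b). l \<le> k"
      using ones_twos_upper[of 3 a b] ones_twos_pos[of a b]
      by (simp_all add: ball_Un)
    ultimately show ?thesis using * n
      by (simp add: partitions_def suc sorted_wrt_append sum_list_replicate ball_Un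
          del: set_replicate)
  next
    case 2
    then obtain a b where *: "p = 3 # 2 # ones_twos a b" "a + 2 * b = n - 5"
      by (auto simp: shapes32_def sols12_def)
    with n have "n = a + 2 * b + 5" "0 < a + b" by linarith+
    with *(1) show ?thesis
      using ones_twos_upper[of 3 a b] ones_twos_upper[of 2 a b] ones_twos_pos[of a b]
      by (simp add: partitions_def suc ones_twos_st)
  next
    case 3
    then obtain s where s: "s \<in> sols112 (n - 6) - {(n - 6, 0, 0)}"
      "p = (\<lambda>(d, a, b). (4 + d) # 2 # ones_twos a b) s"
      unfolding shapes_row_def by (rule imageE)
    obtain d a b where "s = (d, a, b)" by (cases s)
    with s have *: "p = (4 + d) # 2 # ones_twos a b" "(d, a, b) \<in> sols112 (n - 6) - {(n - 6, 0, 0)}"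
      by (simp_all only: prod.case)
    with n have "n = d + a + 2 * b + 6" "0 < a + b" by (auto simp: sols112_def)
    with *(1) show ?thesis
      using ones_twos_upper[of "4 + d" a b] ones_twos_upper[of 2 a b] ones_twos_pos[of a b]
      by (simp add: partitions_def suc ones_twos_st)
  next
    case 4
    then obtain d a b where *: "p = (3 + b + d) # (3 + b) # 1 # replicate a 1"
      "d + a + 2 * b = n - 7"
      by (auto simp: shapes_hook_def sols112_def)
    with n show ?thesis
      by (auto simp: partitions_def suc sum_list_replicate)
  next
    case 5
    then obtain s where s: "s \<in> sols123 (n - 6) - {(n - 6, 0, 0)}"
      "p = (\<lambda>(a, b, c). [2 + c + b + a, 2 + c + b, 2 + c]) s"
      unfolding shapes_rows_def by (rule imageE)
    obtain a b c where "s = (a, b, c)" by (cases s)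
    with s have *: "p = [2 + c + b + a, 2 + c + b, 2 + c]"
      "(a, b, c) \<in> sols123 (n - 6) - {(n - 6, 0, 0)}"
      by (simp_all only: prod.case)
    with n have "n = a + 2 * b + 3 * c + 6" "0 < b + c" by (auto simp: sols123_def)
    with n *(1) show ?thesis
      by (simp add: partitions_def suc)
  qed
qed

text \<open>The bound in the last part is needed: $(3,3,2)$ and $(3,3,3)$ arise both in
  \<open>shapes33\<close> and in \<open>shapes_rows\<close>, for \<open>n\<close> equal to 8 and 9.\<close>

lemma disjoint_shapes:
  "shapes33 n \<inter> shapes32 n = {}"
  "(shapes33 n \<union> shapes32 n) \<inter> shapes_row n = {}"
  "(shapes33 n \<union> shapes32 n \<union> shapes_row n) \<inter> shapes_hook n = {}"
  "n \<ge> 10 \<Longrightarrow> (shapes33 n \<union> shapes32 n \<union> shapes_row n \<union> shapes_hook n) \<inter> shapes_rows n = {}"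
  by (auto simp: shapes_defs sols123_def sols112_def)

lemma card_shapes:
  shows "card (shapes33 n) = card (sols123 (n - 6))"
    and "card (shapes32 n) = card (sols12 (n - 5))"
    and "card (shapes_row n) = card (sols112 (n - 6)) - 1"
    and "card (shapes_hook n) = card (sols112 (n - 7)) - 1"
    and "card (shapes_rows n) = card (sols123 (n - 6)) - 1"
proof -
  show "card (shapes33 n) = card (sols123 (n - 6))"
    unfolding shapes33_def
    by (rule card_image) (auto simp: inj_on_def threes_ones_twos_eq_iff)
  show "card (shapes32 n) = card (sols12 (n - 5))"
    unfolding shapes32_def
    by (rule card_image) (auto simp: inj_on_def ones_twos_eq_iff)
  have "card (shapes_row n) = card (sols112 (n - 6) - {(n - 6, 0, 0)})"
    unfolding shapes_row_def
    by (rule card_image) (auto simp: inj_on_def ones_twos_eq_iff)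
  then show "card (shapes_row n) = card (sols112 (n - 6)) - 1"
    by (simp add: card_Diff_singleton sols112_def)
  have "card (shapes_hook n) = card (sols112 (n - 7) - {(0, n - 7, 0)})"
    unfolding shapes_hook_def
    by (rule card_image) (auto simp: inj_on_def)
  then show "card (shapes_hook n) = card (sols112 (n - 7)) - 1"
    by (simp add: card_Diff_singleton sols112_def)
  have "card (shapes_rows n) = card (sols123 (n - 6) - {(n - 6, 0, 0)})"
    unfolding shapes_rows_def
    by (rule card_image) (auto simp: inj_on_def)
  then show "card (shapes_rows n) = card (sols123 (n - 6)) - 1"
    by (simp add: card_Diff_singleton sols123_def)
qed

lemma card_sols_pos: "0 < card (sols112 n)" "0 < card (sols123 n)"
proof -
  have "(n, 0, 0) \<in> sols112 n" "(n, 0, 0) \<in> sols123 n"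
    by (simp_all add: sols112_def sols123_def)
  then show "0 < card (sols112 n)" "0 < card (sols123 n)"
    by (auto simp: card_gt_0_iff)
qed

lemma rook_count_3:
  assumes n: "n \<ge> 10"
  shows "rook_count 3 n + 3 = 2 * card (sols123 (n - 6)) + card (sols12 (n - 5))
    + card (sols112 (n - 6)) + card (sols112 (n - 7))"
proof -
  have "max_rook p = 3 \<longleftrightarrow> contains_staircase 3 p \<and> \<not> contains_staircase 4 p"
    if "p \<in> partitions n" for p
    using max_rook_eq_iff[of p 3] that by (simp add: partitions_def)
  then have "{p \<in> partitions n. max_rook p = 3} =
      shapes33 n \<union> shapes32 n \<union> shapes_row n \<union> shapes_hook n \<union> shapes_rows n"
    using shapes_sound[OF n] shapes_complete[OF n] by blast
  then have "rook_count 3 n =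
      card (shapes33 n \<union> shapes32 n \<union> shapes_row n \<union> shapes_hook n \<union> shapes_rows n)"
    by (simp add: rook_count_def)
  also have "finite (shapes33 n)" "finite (shapes32 n)" "finite (shapes_row n)"
    "finite (shapes_hook n)" "finite (shapes_rows n)"
    by (simp_all add: shapes_defs)
  then have "card (shapes33 n \<union> shapes32 n \<union> shapes_row n \<union> shapes_hook n \<union> shapes_rows n) =
      card (shapes33 n) + card (shapes32 n) + card (shapes_row n) + card (shapes_hook n)
      + card (shapes_rows n)"
    by (simp only: card_Un_disjoint finite_Un disjoint_shapes n simp_thms)
  finally show ?thesis
    using card_shapes[of n] card_sols_pos(1)[of "n - 6"] card_sols_pos(1)[of "n - 7"]
      card_sols_pos(2)[of "n - 6"] by linarith
qed

theorem corollary3p3: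
  fixes n :: nat
  assumes "n > 14"
  shows "int (rook_count 3 n) =
    2 * int (rook_count 3 (n - 1)) - int (rook_count 3 (n - 2)) + int (rook_count 3 (n - 3))
      - 2 * int (rook_count 3 (n - 4)) + int (rook_count 3 (n - 5))"
proof -
  define m where "m = n - 15"
  with assms have n: "n = m + 15" by simp
  \<comment> \<open>The sum of two consecutive values of \<open>T\<close> has increments without floors.\<close>
  define t where "t k = int (card (sols112 k)) + int (card (sols112 (k - 1)))" for k
  define u where "u k = int (card (sols123 k))" for k
  have R: "int (rook_count 3 k) = 2 * u (k - 6) + int ((k - 5) div 2) + t (k - 6) - 2"
    if "k \<ge> 10" for k
    using rook_count_3[OF that] by (simp add: u_def t_def card_sols12)
  have u: "u (k + 3) = u k + int ((k + 3) div 2) + 1" for k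
    by (simp add: u_def card_sols123_add_3 card_sols12)
  have t: "t (k + 2) = t (k + 1) + int k + 3" for k
    using card_sols112_Suc[of "Suc k"] card_sols112_Suc[of k]
    by (simp add: t_def card_sols12)
  \<comment> \<open>All the floors that occur, in terms of \<open>m div 2\<close>.\<close>
  have halves: "int ((m + 10) div 2) = int (m div 2) + 5" "int ((m + 8) div 2) = int (m div 2) + 4"
    "int ((m + 6) div 2) = int (m div 2) + 3" "int ((m + 9) div 2) = int m - int (m div 2) + 4"
    "int ((m + 7) div 2) = int m - int (m div 2) + 3" "int ((m + 5) div 2) = int m - int (m div 2) + 2"
    by presburger+
  show ?thesis
    using u[of "m + 6"] u[of "m + 5"] u[of "m + 4"] t[of "m + 3"] t[of "m + 4"] t[of "m + 5"]
      t[of "m + 6"] t[of "m + 7"] halves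
    unfolding n by (simp add: R ac_simps)
qed

end
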